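(* Under Assumptions 1 and 2, let $\bm\pi_1$ be the policy that, for $t=1,\dots,n$, sets $\tilde x_t=1$ if $r_t>\bm a_t^\top\bm p^*$ and $\tilde x_t=0$ otherwise, and takes $x_t=\tilde x_t$ if $\sum_{j<t}a_{ij}x_j+a_{it}\tilde x_t\le b_i$ for all $i$, else $x_t=0$. Then there is a constant $K$ independent of $n$ such that $\Delta_n(\bm\pi_1)\le K\sqrt n$ for all $n$, i.e. $\Delta_n(\bm\pi_1)=O(\sqrt n)$.
   Context: Linear program: $\max\sum_{j=1}^n r_jx_j$ s.t. $\sum_{j=1}^n a_{ij}x_j\le b_i$ ($i=1,\dots,m$), $0\le x_j\le1$; $b_i>0$, $d_i=b_i/n$; optimal value $R_n^*$. In the online version $(r_t,\bm a_t)$ is revealed at time $t$ and $x_t$ is chosen irrevocably; $R_n(\bm\pi)=\sum_tr_tx_t$. Assumption 1: (a) $(r_j,\bm a_j)\in\mathbb R\times\mathbb R^m$ i.i.d. from $\mathcal P$; (b) $|r_j|\le\bar r$, $\|\bm a_j\|_2\le\bar a$; (c) $d_i\in(\underline d,\bar d)$, $0<\underline d<\bar d$, $\Omega_d=\prod_i(\underline d,\bar d)$; (d) $n>m$. $f(\bm p)=\bm d^\top\bm p+\mathbb E[(r-\bm a^\top\bm p)^+]$; $\bm p^*$ the minimizer of $f$ over $\bm p\ge0$ (computed with knowledge of $\mathcal P$); $\Omega_p=\{\bm p\ge0:\sum_ip_i\le\bar r/\underline d\}$. Assumption 2 (constants $\lambda_{\min},\lambda,\mu>0$): (a) $\mathbb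 E[\bm a\bm a^\top]$ positive definite, min eigenvalue $\lambda_{\min}$; (b) for every $\bm d\in\Omega_d$ (with corresponding $\bm p^*$) and all $\bm p\in\Omega_p$: $\lambda|\bm a^\top\bm p-\bm a^\top\bm p^*|\le|\mathbb P(r>\bm a^\top\bm p\mid\bm a)-\mathbb P(r>\bm a^\top\bm p^*\mid\bm a)|\le\mu|\bm a^\top\bm p-\bm a^\top\bm p^*|$; (c) $p_i^*=0$ iff $d_i-\mathbb E[a_iI(r>\bm a^\top\bm p^* )]>0$. $\Xi$ = family of such $\mathcal P$. Worst-case regret: $\Delta_n(\bm\pi)=\sup_{\mathcal P\in\Xi}\mathbb E_{\mathcal P}[R_n^*-R_n(\bm\pi)]$. The big-O treats $m$ and the constants of the assumptions as fixed. *)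

theory Defs
  imports "HOL-Probability.Probability"
begin

text \<open>An observation \<open>(r, a)\<close> consists of a reward and a column of the constraint matrix. The
  \<open>n\<close> observations are \<open>w 0, \<dots>, w (n - 1)\<close>, i.e. time is counted from \<open>0\<close>.\<close>

type_synonym 'm obs = "real \<times> (real ^ 'm)"

definition lp_feasible :: "nat \<Rightarrow> real ^ 'm \<Rightarrow> (nat \<Rightarrow> 'm obs) \<Rightarrow> (nat \<Rightarrow> real) set" where
  "lp_feasible n b w =
     {x. (\<forall>i. (\<Sum>j<n. snd (w j) $ i * x j) \<le> b $ i) \<and> (\<forall>j<n. 0 \<le> x j \<and> x j \<le> 1)}"

definition reward :: "nat \<Rightarrow> (nat \<Rightarrow> 'm obs) \<Rightarrow> (nat \<Rightarrow> real) \<Rightarrow> real" where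
  "reward n w x = (\<Sum>j<n. fst (w j) * x j)"

definition lp_value :: "nat \<Rightarrow> real ^ 'm \<Rightarrow> (nat \<Rightarrow> 'm obs) \<Rightarrow> real" where
  "lp_value n b w = (SUP x \<in> lp_feasible n b w. reward n w x)"

definition dual_objective :: "'m obs measure \<Rightarrow> real ^ 'm \<Rightarrow> real ^ 'm \<Rightarrow> real" where
  "dual_objective P d p = d \<bullet> p + (\<integral>z. max 0 (fst z - snd z \<bullet> p) \<partial>P)"

text \<open>For \<open>d\<close> with positive entries and a boundedly supported \<open>P\<close> the objective is continuous and
  coercive on the nonnegative orthant, so that a minimizer exists.\<close>

definition p_star :: "'m obs measure \<Rightarrow> real ^ 'm \<Rightarrow> real ^ 'm" where
  "p_star P d = arg_min_on (dual_objective P d) {p. \<forall>i. 0 \<le> p $ i}"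

definition Omega_d :: "real \<Rightarrow> real \<Rightarrow> (real ^ 'm) set" where
  "Omega_d d_lo d_hi = {d. \<forall>i. d_lo < d $ i \<and> d $ i < d_hi}"

definition Omega_p :: "real \<Rightarrow> real \<Rightarrow> (real ^ 'm) set" where
  "Omega_p r_bar d_lo = {p. (\<forall>i. 0 \<le> p $ i) \<and> (\<Sum>i\<in>UNIV. p $ i) \<le> r_bar / d_lo}"

definition second_moment :: "'m obs measure \<Rightarrow> real ^ 'm ^ 'm" where
  "second_moment P = (\<chi> i j. \<integral>z. snd z $ i * snd z $ j \<partial>P)"

definition positive_definite :: "real ^ 'm ^ 'm \<Rightarrow> bool" where
  "positive_definite A \<longleftrightarrow> transpose A = A \<and> (\<forall>x. x \<noteq> 0 \<longrightarrow> 0 < x \<bullet> (A *v x))"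

definition eigenvalue :: "real ^ 'm ^ 'm \<Rightarrow> real \<Rightarrow> bool" where
  "eigenvalue A e \<longleftrightarrow> (\<exists>v. v \<noteq> 0 \<and> A *v v = e *\<^sub>R v)"

definition is_min_eigenvalue :: "real ^ 'm ^ 'm \<Rightarrow> real \<Rightarrow> bool" where
  "is_min_eigenvalue A e \<longleftrightarrow> eigenvalue A e \<and> (\<forall>e'. eigenvalue A e' \<longrightarrow> e \<le> e')"

text \<open>The conditional probability of \<open>r > a\<^sup>T p\<close> given \<open>a\<close>: conditioning is on the \<open>\<sigma>\<close>-algebra
  generated by the second component.\<close>

definition accept_prob :: "'m obs measure \<Rightarrow> real ^ 'm \<Rightarrow> 'm obs \<Rightarrow> real" where
  "accept_prob P p =
     real_cond_exp P (vimage_algebra (space P) snd borel)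
       (indicator {z. fst z > snd z \<bullet> p})"

definition bounded_obs :: "real \<Rightarrow> real \<Rightarrow> ('m::finite) obs measure \<Rightarrow> bool" where
  "bounded_obs r_bar a_bar P \<longleftrightarrow> (AE z in P. \<bar>fst z\<bar> \<le> r_bar \<and> norm (snd z) \<le> a_bar)"

text \<open>A conditional probability is determined only almost everywhere for each fixed \<open>p\<close>, so the
  exceptional null set may depend on \<open>p\<close>.\<close>

definition accept_prob_regular ::
  "real \<Rightarrow> real \<Rightarrow> real \<Rightarrow> real \<Rightarrow> real \<Rightarrow> ('m::finite) obs measure \<Rightarrow> bool" where
  "accept_prob_regular r_bar d_lo d_hi lam mu P \<longleftrightarrow>
     (\<forall>d \<in> Omega_d d_lo d_hi. \<forall>p \<in> Omega_p r_bar d_lo. AE z in P.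
        lam * \<bar>snd z \<bullet> p - snd z \<bullet> p_star P d\<bar>
          \<le> \<bar>accept_prob P p z - accept_prob P (p_star P d) z\<bar> \<and>
        \<bar>accept_prob P p z - accept_prob P (p_star P d) z\<bar>
          \<le> mu * \<bar>snd z \<bullet> p - snd z \<bullet> p_star P d\<bar>)"

definition strict_complementarity :: "real ^ 'm \<Rightarrow> 'm obs measure \<Rightarrow> bool" where
  "strict_complementarity d P \<longleftrightarrow>
     (\<forall>i. p_star P d $ i = 0 \<longleftrightarrow>
        d $ i - (\<integral>z. snd z $ i * indicator {z. fst z > snd z \<bullet> p_star P d} z \<partial>P) > 0)"

definition Xi ::
  "real \<Rightarrow> real \<Rightarrow> real \<Rightarrow> real \<Rightarrow> real \<Rightarrow> real \<Rightarrow> real \<Rightarrow> real ^ 'm \<Rightarrow> 'm obs measure set" where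
  "Xi r_bar a_bar d_lo d_hi lam_min lam mu d =
     {P. prob_space P \<and> sets P = sets borel \<and>
         bounded_obs r_bar a_bar P \<and>
         positive_definite (second_moment P) \<and>
         is_min_eigenvalue (second_moment P) lam_min \<and>
         accept_prob_regular r_bar d_lo d_hi lam mu P \<and>
         strict_complementarity d P}"

text \<open>A policy maps the distribution (which it may use, e.g. through \<open>p_star\<close>) and the
  observations to the decisions. The supremum is taken in the extended reals, so that an unbounded
  family of regrets yields \<open>\<infinity>\<close>.\<close>

definition worst_case_regret ::
  "'m obs measure set \<Rightarrow> nat \<Rightarrow> real ^ 'm \<Rightarrow>
   ('m obs measure \<Rightarrow> (nat \<Rightarrow> 'm obs) \<Rightarrow> nat \<Rightarrow> real) \<Rightarrow> ereal" where
  "worst_case_regret \<P> n b \<pi> =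
     (SUP P \<in> \<P>. ereal (\<integral>w. lp_value n b w - reward n w (\<pi> P w) \<partial>(PiM {..<n} (\<lambda>_. P))))"

definition threshold_decision :: "real ^ 'm \<Rightarrow> 'm obs \<Rightarrow> real" where
  "threshold_decision p z = (if fst z > snd z \<bullet> p then 1 else 0)"

function threshold_policy :: "real ^ 'm \<Rightarrow> real ^ 'm \<Rightarrow> (nat \<Rightarrow> 'm obs) \<Rightarrow> nat \<Rightarrow> real" where
  "threshold_policy b p w t =
     (if \<forall>i. (\<Sum>j\<in>{..<t}. snd (w j) $ i * threshold_policy b p w j)
              + snd (w t) $ i * threshold_decision p (w t) \<le> b $ i
      then threshold_decision p (w t) else 0)"
  by pat_completeness auto
termination by (relation "Wellfounded.measure (\<lambda>(b, p, w, t). t)") auto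

declare threshold_policy.simps [simp del]

definition policy1 ::
  "nat \<Rightarrow> real ^ 'm \<Rightarrow> 'm obs measure \<Rightarrow> (nat \<Rightarrow> 'm obs) \<Rightarrow> nat \<Rightarrow> real" where
  "policy1 n d P = threshold_policy (real n *\<^sub>R d) (p_star P d)"

end

theory Submission
  imports Defs
begin

text \<open>Weak duality at \<open>p\<^sup>*\<close> bounds the offline value by the reward of the unconstrained threshold
  rule \<open>y\<^sub>t = I(r\<^sub>t > a\<^sub>t\<^sup>T p\<^sup>*)\<close> plus \<open>p\<^sup>* \<bullet> (n d - \<Sum>\<^sub>t a\<^sub>t y\<^sub>t)\<close>, whose mean is nonpositive by
  complementarity. Hence the regret is at most \<open>r_bar\<close> times the expected number of rejections. The
  first rejection happens no earlier than the first time \<open>T\<close> at which \<open>y\<close> overspends some resource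
  \<open>i\<close>. Optimality of \<open>p\<^sup>*\<close> gives \<open>E[a\<^sub>i y] \<le> d\<^sub>i\<close>, so at time \<open>T\<close> the centred consumption of
  resource \<open>i\<close> exceeds \<open>(n - T) d\<^sub>i\<close>. The centred consumption stopped at \<open>T\<close> is a martingale with
  bounded increments, so its second moment is \<open>O(n)\<close>, which gives \<open>E[n - T] = O(\<surd>n)\<close>.\<close>

section \<open>Pathwise analysis: weak duality and counting rejections\<close>

text \<open>Lagrangian relaxation: a feasible \<open>x\<close> uses resources worth at most
  \<open>b \<bullet> p\<close>, and what remains of the rewards is maximized separately over each
  \<open>x j\<close> in [0, 1], which leaves the positive parts.\<close>

lemma lp_value_le_dual:
  fixes b p :: "real ^ 'm::finite"
  assumes b: "\<And>i. 0 \<le> b $ i" and p: "\<And>i. 0 \<le> p $ i"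
  shows "lp_value n b w \<le> b \<bullet> p + (\<Sum>j<n. max 0 (fst (w j) - snd (w j) \<bullet> p))"
  unfolding lp_value_def
proof (rule cSUP_least)
  \<comment> \<open>The supremum is taken in the reals, so an upper bound needs a nonempty set;
    doing nothing is feasible because \<open>b\<close> is nonnegative.\<close>
  have "(\<lambda>_. 0) \<in> lp_feasible n b w"
    using b by (simp add: lp_feasible_def)
  then show "lp_feasible n b w \<noteq> {}" by blast
next
  fix x assume "x \<in> lp_feasible n b w"
  then have budget: "(\<Sum>j<n. snd (w j) $ i * x j) \<le> b $ i"
    and x01: "j < n \<Longrightarrow> 0 \<le> x j \<and> x j \<le> 1" for i j
    by (auto simp: lp_feasible_def)
  have "(\<Sum>j<n. snd (w j) \<bullet> p * x j) = (\<Sum>j<n. \<Sum>i\<in>UNIV. p $ i * (snd (w j) $ i * x j))"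
    by (simp add: inner_vec_def sum_distrib_left sum_distrib_right algebra_simps)
  also have "\<dots> = (\<Sum>i\<in>UNIV. p $ i * (\<Sum>j<n. snd (w j) $ i * x j))"
    by (subst sum.swap) (simp add: sum_distrib_left)
  also have "\<dots> \<le> (\<Sum>i\<in>UNIV. p $ i * b $ i)"
    by (intro sum_mono mult_left_mono budget p)
  finally have "(\<Sum>j<n. snd (w j) \<bullet> p * x j) \<le> b \<bullet> p"
    by (simp add: inner_vec_def mult.commute)
  moreover have "(\<Sum>j<n. (fst (w j) - snd (w j) \<bullet> p) * x j)
      \<le> (\<Sum>j<n. max 0 (fst (w j) - snd (w j) \<bullet> p))"
  proof (rule sum_mono)
    fix j assume "j \<in> {..<n}"
    then have x: "0 \<le> x j" "x j \<le> 1" using x01 by auto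
    have "(fst (w j) - snd (w j) \<bullet> p) * x j \<le> max 0 (fst (w j) - snd (w j) \<bullet> p) * x j"
      using x by (intro mult_right_mono) auto
    also have "\<dots> \<le> max 0 (fst (w j) - snd (w j) \<bullet> p)"
      using x by (intro mult_left_le) auto
    finally show "(fst (w j) - snd (w j) \<bullet> p) * x j \<le> max 0 (fst (w j) - snd (w j) \<bullet> p)" .
  qed
  moreover have "reward n w x = (\<Sum>j<n. (fst (w j) - snd (w j) \<bullet> p) * x j)
      + (\<Sum>j<n. snd (w j) \<bullet> p * x j)"
    by (simp add: reward_def left_diff_distrib flip: sum.distrib)
  ultimately show "reward n w x \<le> b \<bullet> p + (\<Sum>j<n. max 0 (fst (w j) - snd (w j) \<bullet> p))"
    by linarith
qed

text \<open>Only observations before time \<open>t\<close> enter, so the indicator of this event is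
  a predictable weight. Every prefix is checked because entries of \<open>a\<close> may be negative:
  a sum can return below the budget after an overrun.\<close>

definition within_budget :: "real ^ 'm \<Rightarrow> real ^ 'm \<Rightarrow> nat \<Rightarrow> (nat \<Rightarrow> 'm obs) \<Rightarrow> bool" where
  "within_budget b p t w \<longleftrightarrow>
     (\<forall>s<t. \<forall>i. (\<Sum>j<Suc s. snd (w j) $ i * threshold_decision p (w j)) \<le> b $ i)"

text \<open>By strong induction all earlier decisions agree, so the budget test of the policy at
  \<open>t\<close> is the test on the prefix of length \<open>Suc t\<close> of the unconstrained
  rule.\<close>

lemma threshold_policy_eq_decision:
  assumes "within_budget b p (Suc t) w"
  shows "threshold_policy b p w t = threshold_decision p (w t)"
  using assms
proof (induction t rule: less_induct)
  case (less t)
  have "threshold_policy b p w j = threshold_decision p (w j)" if "j < t" for j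
    using less that by (auto simp: within_budget_def)
  then have "(\<Sum>j<t. snd (w j) $ i * threshold_policy b p w j)
      + snd (w t) $ i * threshold_decision p (w t) \<le> b $ i" for i
    using less.prems by (auto simp: within_budget_def)
  then show ?case by (subst threshold_policy.simps) auto
qed

lemma threshold_policy_cases:
  "threshold_policy b p w t = threshold_decision p (w t) \<or> threshold_policy b p w t = 0"
  by (subst (1 2) threshold_policy.simps) auto

text \<open>With \<open>g\<close> the mean consumption this is the centred consumption stopped at
  the first overrun. The overrunning step itself is still counted, since its weight looks only at
  earlier steps.\<close>

definition stopped_excess ::
  "real ^ 'm \<Rightarrow> real ^ 'm \<Rightarrow> real ^ 'm \<Rightarrow> 'm \<Rightarrow> nat \<Rightarrow> (nat \<Rightarrow> 'm obs) \<Rightarrow> real" where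
  "stopped_excess b p g i n w =
     (\<Sum>j<n. of_bool (within_budget b p j w) * (snd (w j) $ i * threshold_decision p (w j) - g $ i))"

text \<open>Rejections can occur only from the first overrun step \<open>s\<close> on, so there are
  at most \<open>n - s\<close>. The excess of the overrun resource is at least
  \<open>(n - Suc s) * d_lo\<close>, and the summand \<open>1\<close> covers step \<open>s\<close>
  itself.\<close>

lemma card_rejections_le:
  fixes d g p :: "real ^ 'm::finite" and n :: nat
  assumes d_lo: "0 < d_lo" "\<And>i. d_lo \<le> d $ i" and g: "\<And>i. g $ i \<le> d $ i"
  defines "b \<equiv> real n *\<^sub>R d"
  shows "real (card {t. t < n \<and> threshold_policy b p w t \<noteq> threshold_decision p (w t)})
    \<le> 1 + (\<Sum>i\<in>UNIV. \<bar>stopped_excess b p g i n w\<bar>) / d_lo" (is "real (card ?R) \<le> _")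
proof (cases "within_budget b p n w")
  case True
  then have "threshold_policy b p w t = threshold_decision p (w t)" if "t < n" for t
    using that by (intro threshold_policy_eq_decision) (auto simp: within_budget_def)
  then have "?R = {}" by blast
  then have "real (card ?R) = 0" by (simp only: card.empty of_nat_0)
  moreover have "0 \<le> (\<Sum>i\<in>UNIV. \<bar>stopped_excess b p g i n w\<bar>) / d_lo"
    using d_lo by (simp add: sum_nonneg)
  ultimately show ?thesis by linarith
next
  case False
  define V where "V s \<longleftrightarrow>
    (\<exists>i. (\<Sum>j<Suc s. snd (w j) $ i * threshold_decision p (w j)) > b $ i)" for s
  have within_iff: "within_budget b p t w \<longleftrightarrow> (\<forall>s<t. \<not> V s)" for t
    by (simp add: within_budget_def V_def not_less)
  define s where "s = (LEAST s. V s)"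
  from False obtain s' where s': "s' < n" "V s'" using within_iff by blast
  then have s: "V s" "s < n" and least: "\<And>t. t < s \<Longrightarrow> \<not> V t"
    unfolding s_def by (auto intro: LeastI Least_le le_less_trans dest: not_less_Least)
  have within_iff_le: "within_budget b p t w \<longleftrightarrow> t \<le> s" for t
    unfolding within_iff using s least by (meson le_less_trans not_le less_le_trans)
  have "?R \<subseteq> {s..<n}"
    using threshold_policy_eq_decision within_iff_le by (fastforce simp: not_less_eq_eq)
  then have "card ?R \<le> n - s" using card_mono[of "{s..<n}" ?R] by simp
  then have card: "real (card ?R) \<le> real n - real s" using s by linarith
  from s obtain i where i: "(\<Sum>j<Suc s. snd (w j) $ i * threshold_decision p (w j)) > b $ i"
    by (auto simp: V_def)
  \<comment> \<open>The weights are one up to and including \<open>s\<close> and zero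
    afterwards.\<close>
  have "stopped_excess b p g i n w
      = (\<Sum>j<Suc s. snd (w j) $ i * threshold_decision p (w j) - g $ i)"
    unfolding stopped_excess_def within_iff_le
    by (rule sum.mono_neutral_cong_right) (use s in auto)
  also have "\<dots> = (\<Sum>j<Suc s. snd (w j) $ i * threshold_decision p (w j)) - real (Suc s) * g $ i"
    by (simp only: sum_subtractf sum_constant card_lessThan)
  \<comment> \<open>The overrun bounds the first term from below by \<open>b $ i\<close>, and
    \<open>g $ i \<le> d $ i\<close> handles the centring.\<close>
  also have "\<dots> \<ge> real n * d $ i - real (Suc s) * d $ i"
    using i g[of i] by (intro diff_mono mult_left_mono) (auto simp: b_def)
  finally have "(real n - real (Suc s)) * d $ i \<le> stopped_excess b p g i n w"
    by (simp only: left_diff_distrib)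
  moreover have "(real n - real (Suc s)) * d_lo \<le> (real n - real (Suc s)) * d $ i"
    using s d_lo by (intro mult_left_mono) auto
  moreover have "\<bar>stopped_excess b p g i n w\<bar> \<le> (\<Sum>i\<in>UNIV. \<bar>stopped_excess b p g i n w\<bar>)"
    by (rule member_le_sum) auto
  ultimately have "(real n - real (Suc s)) * d_lo \<le> (\<Sum>i\<in>UNIV. \<bar>stopped_excess b p g i n w\<bar>)"
    by linarith
  then have "real n - real (Suc s) \<le> (\<Sum>i\<in>UNIV. \<bar>stopped_excess b p g i n w\<bar>) / d_lo"
    using d_lo by (simp add: pos_le_divide_eq)
  with card show ?thesis by simp
qed

text \<open>The reward of the unconstrained rule is inserted between the two sides: its distance to
  the dual bound is the priced slack, and each rejection costs at most \<open>r_bar\<close>.\<close>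

lemma regret_pathwise:
  fixes d g p :: "real ^ 'm::finite" and n :: nat
  assumes d_lo: "0 < d_lo" "\<And>i. d_lo \<le> d $ i" and g: "\<And>i. g $ i \<le> d $ i"
    and p: "\<And>i. 0 \<le> p $ i" and r_bar: "0 \<le> r_bar" and r: "\<And>j. j < n \<Longrightarrow> \<bar>fst (w j)\<bar> \<le> r_bar"
  defines "b \<equiv> real n *\<^sub>R d"
  shows "lp_value n b w - reward n w (threshold_policy b p w)
    \<le> r_bar * (1 + (\<Sum>i\<in>UNIV. \<bar>stopped_excess b p g i n w\<bar>) / d_lo)
      + (\<Sum>j<n. \<Sum>i\<in>UNIV. p $ i * (d $ i - snd (w j) $ i * threshold_decision p (w j)))"
proof -
  let ?x = "threshold_policy b p w" and ?y = "\<lambda>j. threshold_decision p (w j)"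
  let ?R = "{t. t < n \<and> ?x t \<noteq> ?y t}"
  have "b $ i \<ge> 0" for i using d_lo order_trans[of 0 d_lo "d $ i"] by (simp add: b_def)
  then have "lp_value n b w \<le> b \<bullet> p + (\<Sum>j<n. max 0 (fst (w j) - snd (w j) \<bullet> p))"
    by (intro lp_value_le_dual p)
  \<comment> \<open>The threshold rule accepts exactly where the margin is positive, so it attains
    every positive part.\<close>
  also have "(\<Sum>j<n. max 0 (fst (w j) - snd (w j) \<bullet> p))
      = (\<Sum>j<n. fst (w j) * ?y j) - (\<Sum>j<n. snd (w j) \<bullet> p * ?y j)"
    unfolding sum_subtractf[symmetric]
    by (rule sum.cong) (auto simp: threshold_decision_def)
  also have "b \<bullet> p + \<dots> = (\<Sum>j<n. fst (w j) * ?y j)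
      + (\<Sum>j<n. \<Sum>i\<in>UNIV. p $ i * (d $ i - snd (w j) $ i * ?y j))"
    by (simp add: b_def inner_vec_def sum_distrib_left sum_distrib_right sum_subtractf algebra_simps)
  finally have dual: "lp_value n b w \<le> \<dots>" .
  have "(\<Sum>j<n. fst (w j) * ?y j) - reward n w ?x = (\<Sum>j<n. fst (w j) * (?y j - ?x j))"
    by (simp add: reward_def right_diff_distrib sum_subtractf)
  \<comment> \<open>The decisions can differ only where the rule takes \<open>1\<close> and the
    policy \<open>0\<close>.\<close>
  also have "\<dots> \<le> (\<Sum>j<n. if j \<in> ?R then r_bar else 0)"
  proof (rule sum_mono)
    fix j assume "j \<in> {..<n}"
    then show "fst (w j) * (?y j - ?x j) \<le> (if j \<in> ?R then r_bar else 0)"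
      using threshold_policy_cases[of b p w j] r[of j] r_bar
      by (auto simp: threshold_decision_def split: if_splits)
  qed
  also have "\<dots> = r_bar * real (card ?R)"
    by (subst sum.If_cases) (auto simp: Int_def intro!: arg_cong[where f=card])
  also have "\<dots> \<le> r_bar * (1 + (\<Sum>i\<in>UNIV. \<bar>stopped_excess b p g i n w\<bar>) / d_lo)"
    unfolding b_def by (intro mult_left_mono card_rejections_le d_lo g r_bar)
  finally show ?thesis using dual by linarith
qed

section \<open>Sums with predictable weights on a product space\<close>

lemma (in prob_space) PiM_component:
  fixes f :: "'a \<Rightarrow> real"
  assumes "j \<in> I" and f: "integrable M f"
  shows "integrable (PiM I (\<lambda>_. M)) (\<lambda>w. f (w j))"
    and "(\<integral>w. f (w j) \<partial>PiM I (\<lambda>_. M)) = expectation f"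
proof -
  have distr: "distr (PiM I (\<lambda>_. M)) M (\<lambda>w. w j) = M"
    using distr_PiM_component[of I "\<lambda>_. M" j] prob_space_axioms assms by simp
  have meas: "(\<lambda>w. w j) \<in> measurable (PiM I (\<lambda>_. M)) M"
    using assms by (intro measurable_component_singleton)
  show "integrable (PiM I (\<lambda>_. M)) (\<lambda>w. f (w j))"
    using integrable_distr[OF meas, of f] f by (simp add: distr)
  show "(\<integral>w. f (w j) \<partial>PiM I (\<lambda>_. M)) = expectation f"
    using integral_distr[OF meas, of f] f by (simp add: distr)
qed

text \<open>Orthogonality of martingale differences: \<open>A_upd\<close> makes \<open>A t\<close>
  blind to changes at coordinates from \<open>t\<close> on, so mixed terms vanish and each step adds
  at most \<open>B\<^sup>2\<close>.\<close>

lemma (in prob_space) predictable_sum_square: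
  fixes X :: "'a \<Rightarrow> real" and A :: "nat \<Rightarrow> (nat \<Rightarrow> 'a) \<Rightarrow> real"
  assumes X [measurable]: "X \<in> borel_measurable M"
    and X_le: "AE x in M. \<bar>X x\<bar> \<le> B" and X_mean: "expectation X = 0"
    and A: "\<And>t n. t \<le> n \<Longrightarrow> A t \<in> borel_measurable (PiM {..<n} (\<lambda>_. M))"
    and A_le: "\<And>t w. \<bar>A t w\<bar> \<le> 1"
    and A_upd: "\<And>t k w z. t \<le> k \<Longrightarrow> A t (w(k := z)) = A t w"
  defines "S \<equiv> \<lambda>n w. \<Sum>j<n. A j w * X (w j)"
  shows "integrable (PiM {..<n} (\<lambda>_. M)) (S n)"
    and "integrable (PiM {..<n} (\<lambda>_. M)) (\<lambda>w. (S n w)\<^sup>2)"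
    and "(\<integral>w. (S n w)\<^sup>2 \<partial>PiM {..<n} (\<lambda>_. M)) \<le> real n * B\<^sup>2"
proof -
  let ?PM = "\<lambda>n. PiM {..<n::nat} (\<lambda>_. M)"
  interpret PM: prob_space "?PM n" for n
    by (intro prob_space_PiM prob_space_axioms)
  interpret product_sigma_finite "\<lambda>_::nat. M" ..
  have "AE x in M. 0 \<le> B" using X_le by eventually_elim auto
  then have B: "0 \<le> B" by simp
  have A_meas [measurable]: "A t \<in> borel_measurable (?PM n)" if "t \<le> n" for t n
    using A that .
  have S_meas [measurable]: "S n \<in> borel_measurable (?PM n)" for n
    unfolding S_def by (intro borel_measurable_sum borel_measurable_times A_meas) auto
  have S_le: "AE w in ?PM n. \<bar>S n w\<bar> \<le> real n * B" for n
  proof -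
    have "AE w in ?PM n. \<forall>j\<in>{..<n}. \<bar>X (w j)\<bar> \<le> B"
      by (intro AE_finite_allI AE_PiM_component X_le prob_space_axioms) auto
    then show ?thesis
    proof eventually_elim
      case (elim w)
      have "\<bar>S n w\<bar> \<le> (\<Sum>j<n. \<bar>A j w * X (w j)\<bar>)" unfolding S_def by (rule sum_abs)
      also have "\<dots> \<le> (\<Sum>j<n. 1 * B)"
        unfolding abs_mult by (intro sum_mono mult_mono A_le) (use elim in auto)
      finally show ?case by simp
    qed
  qed
  show int_S: "integrable (?PM n) (S n)" for n
    by (rule PM.integrable_const_bound[where B="real n * B"]) (use S_le in auto)
  show int_S2: "integrable (?PM n) (\<lambda>w. (S n w)\<^sup>2)" for n
  proof (rule PM.integrable_const_bound[where B="(real n * B)\<^sup>2"])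
    show "AE w in ?PM n. norm ((S n w)\<^sup>2) \<le> (real n * B)\<^sup>2"
      using S_le[of n]
    proof eventually_elim
      case (elim w)
      then show ?case using power_mono[of "\<bar>S n w\<bar>" "real n * B" 2] by simp
    qed
  qed simp
  have int_X: "integrable M X"
    by (rule integrable_const_bound[where B=B]) (use X_le in auto)
  have X2_le: "AE x in M. (X x)\<^sup>2 \<le> B\<^sup>2"
    using X_le
  proof eventually_elim
    case (elim x)
    then show ?case using power_mono[of "\<bar>X x\<bar>" B 2] by simp
  qed
  have int_X2: "integrable M (\<lambda>x. (X x)\<^sup>2)"
    by (rule integrable_const_bound[where B="B\<^sup>2"]) (use X2_le in auto)
  define V where "V = expectation (\<lambda>x. (X x)\<^sup>2)"
  have "V \<le> expectation (\<lambda>_. B\<^sup>2)"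
    unfolding V_def by (rule integral_mono_AE) (use int_X2 X2_le in auto)
  then have V: "0 \<le> V" "V \<le> B\<^sup>2" by (simp_all add: V_def prob_space)
  show "(\<integral>w. (S n w)\<^sup>2 \<partial>?PM n) \<le> real n * B\<^sup>2"
  proof (induction n)
    case 0
    show ?case by (simp add: S_def)
  next
    case (Suc n)
    have S_Suc: "S (Suc n) (w(n := z)) = S n w + A n w * X z" for w z
      by (simp add: S_def A_upd)
    \<comment> \<open>The newest coordinate is integrated out with the history \<open>w\<close>
      fixed; the cross term disappears because \<open>X\<close> has mean zero.\<close>
    have inner: "expectation (\<lambda>z. (S n w + A n w * X z)\<^sup>2) = (S n w)\<^sup>2 + (A n w)\<^sup>2 * V" for w
    proof -
      have "expectation (\<lambda>z. (S n w + A n w * X z)\<^sup>2)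
          = expectation (\<lambda>z. (S n w)\<^sup>2 + 2 * S n w * A n w * X z + (A n w)\<^sup>2 * (X z)\<^sup>2)"
        by (simp add: power2_sum power_mult_distrib algebra_simps)
      also have "\<dots> = (S n w)\<^sup>2 + (A n w)\<^sup>2 * V"
        using int_X int_X2 by (simp add: X_mean V_def prob_space)
      finally show ?thesis .
    qed
    have A2_le: "(A n w)\<^sup>2 \<le> 1" for w
      using A_le[of n w] by (simp add: abs_square_le_1)
    have int_A2: "integrable (?PM n) (\<lambda>w. (A n w)\<^sup>2 * V)"
    proof (rule PM.integrable_const_bound[where B=V])
      show "AE w in ?PM n. norm ((A n w)\<^sup>2 * V) \<le> V"
        using A2_le V by (auto intro!: AE_I2 mult_left_le_one_le simp: abs_mult)
    qed simp
    have "(\<integral>w. (S (Suc n) w)\<^sup>2 \<partial>?PM (Suc n)) = (\<integral>w. (S n w)\<^sup>2 + (A n w)\<^sup>2 * V \<partial>?PM n)"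
      using product_integral_insert[of "{..<n}" n "\<lambda>w. (S (Suc n) w)\<^sup>2"] int_S2[of "Suc n"]
      by (simp add: S_Suc inner lessThan_Suc)
    also have "\<dots> \<le> (\<integral>w. (S n w)\<^sup>2 + B\<^sup>2 \<partial>?PM n)"
    proof (rule integral_mono)
      show "(S n w)\<^sup>2 + (A n w)\<^sup>2 * V \<le> (S n w)\<^sup>2 + B\<^sup>2" for w
        using mult_right_mono[OF A2_le, of V w] V by linarith
    qed (use int_S2 int_A2 in auto)
    also have "\<dots> \<le> real (Suc n) * B\<^sup>2"
      using Suc int_S2[of n] by (simp add: PM.prob_space algebra_simps)
    finally show ?case .
  qed
qed

section \<open>The dual objective and existence of its minimizer\<close>

lemma indicator_accept: "indicator {z. fst z > snd z \<bullet> p} = threshold_decision p"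
  by (auto simp: fun_eq_iff threshold_decision_def)

lemma threshold_decision_altdef:
  "threshold_decision p z = indicator {0<..} (fst z - snd z \<bullet> p)"
  by (simp add: threshold_decision_def indicator_def)

lemma compact_Omega_p: "compact (Omega_p c e :: (real ^ 'm) set)"
proof -
  have "closed ({p :: real ^ 'm. \<forall>i. 0 \<le> p $ i} \<inter> {p. (\<Sum>i\<in>UNIV. p $ i) \<le> c / e})"
    by (intro closed_Int closed_Collect_all closed_Collect_le continuous_intros)
  then have "closed (Omega_p c e :: (real ^ 'm) set)"
    by (simp add: Omega_p_def Collect_conj_eq)
  moreover have "norm p \<le> c / e" if "p \<in> Omega_p c e" for p :: "real ^ 'm"
    using that norm_le_l1_cart[of p] by (auto simp: Omega_p_def)
  then have "bounded (Omega_p c e :: (real ^ 'm) set)"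
    by (auto simp: bounded_iff)
  ultimately show ?thesis by (simp add: compact_eq_bounded_closed)
qed

locale bounded_observations = prob_space P for P :: "('m::finite) obs measure" +
  fixes r_bar a_bar :: real
  assumes sets_P: "sets P = sets borel" and bounded: "bounded_obs r_bar a_bar P"
begin

lemma measurable_P [measurable_cong]: "sets P = sets (borel :: 'm obs measure)"
  by (rule sets_P)

lemma space_P: "space P = UNIV"
  using sets_eq_imp_space_eq[OF sets_P] by simp

lemma AE_bounded: "AE z in P. \<bar>fst z\<bar> \<le> r_bar \<and> norm (snd z) \<le> a_bar"
  using bounded by (simp add: bounded_obs_def)

lemma bounds_nonneg: "0 \<le> r_bar" "0 \<le> a_bar"
proof -
  have "AE z in P. 0 \<le> r_bar \<and> 0 \<le> a_bar"
    using AE_bounded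
    by eventually_elim (auto intro: order_trans[OF abs_ge_zero] order_trans[OF norm_ge_zero])
  then show "0 \<le> r_bar" "0 \<le> a_bar" by simp_all
qed

lemma measurable_snd_nth [measurable]: "(\<lambda>z. snd z $ i) \<in> borel_measurable P"
  unfolding measurable_cong_sets[OF sets_P refl]
  by (intro borel_measurable_continuous_onI continuous_intros)

lemma measurable_margin [measurable]: "(\<lambda>z. fst z - snd z \<bullet> p) \<in> borel_measurable P"
  unfolding measurable_cong_sets[OF sets_P refl]
  by (intro borel_measurable_continuous_onI continuous_intros)

lemma measurable_threshold_decision [measurable]: "threshold_decision p \<in> borel_measurable P"
  unfolding threshold_decision_altdef[abs_def] by measurable

lemma integrable_margin: "integrable P (\<lambda>z. max 0 (fst z - snd z \<bullet> p))"
proof (rule integrable_const_bound[where B="r_bar + a_bar * norm p"])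
  show "AE z in P. norm (max 0 (fst z - snd z \<bullet> p)) \<le> r_bar + a_bar * norm p"
    using AE_bounded
  proof eventually_elim
    case (elim z)
    have "\<bar>snd z \<bullet> p\<bar> \<le> norm (snd z) * norm p" by (rule Cauchy_Schwarz_ineq2)
    also have "\<dots> \<le> a_bar * norm p" using elim by (intro mult_right_mono) auto
    finally show ?case using elim by auto
  qed
qed measurable

lemma abs_consumption_le:
  assumes "norm (snd z) \<le> a_bar"
  shows "\<bar>snd z $ i * threshold_decision p z\<bar> \<le> a_bar"
  using component_le_norm_cart[of "snd z" i] norm_ge_zero[of "snd z"] assms
  by (simp add: threshold_decision_def del: norm_ge_zero)

lemma integrable_consumption: "integrable P (\<lambda>z. snd z $ i * threshold_decision p z)"
proof (rule integrable_const_bound[where B=a_bar])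
  show "AE z in P. norm (snd z $ i * threshold_decision p z) \<le> a_bar"
    using AE_bounded by eventually_elim (use abs_consumption_le in auto)
qed measurable

definition consumption :: "real ^ 'm \<Rightarrow> real ^ 'm" where
  "consumption p = (\<chi> i. \<integral>z. snd z $ i * threshold_decision p z \<partial>P)"

lemma abs_consumption_nth_le: "\<bar>consumption p $ i\<bar> \<le> a_bar"
proof -
  have "\<bar>consumption p $ i\<bar> \<le> (\<integral>z. \<bar>snd z $ i * threshold_decision p z\<bar> \<partial>P)"
    by (simp add: consumption_def)
  also have "\<dots> \<le> (\<integral>z. a_bar \<partial>P)"
  proof (rule integral_mono_AE)
    show "AE z in P. \<bar>snd z $ i * threshold_decision p z\<bar> \<le> a_bar"
      using AE_bounded by eventually_elim (use abs_consumption_le in auto)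
  qed (use integrable_consumption in auto)
  finally show ?thesis by (simp add: prob_space)
qed

lemma dual_objective_lipschitz:
  "\<bar>dual_objective P d p - dual_objective P d q\<bar> \<le> (norm d + a_bar) * norm (p - q)"
proof -
  let ?h = "\<lambda>p z. max 0 (fst z - snd z \<bullet> p)"
  have "\<bar>(\<integral>z. ?h p z \<partial>P) - (\<integral>z. ?h q z \<partial>P)\<bar> = \<bar>\<integral>z. ?h p z - ?h q z \<partial>P\<bar>"
    using integrable_margin by simp
  also have "\<dots> \<le> (\<integral>z. \<bar>?h p z - ?h q z\<bar> \<partial>P)"
    by (rule integral_abs_bound)
  also have "\<dots> \<le> (\<integral>z. a_bar * norm (p - q) \<partial>P)"
  proof (rule integral_mono_AE)
    show "AE z in P. \<bar>?h p z - ?h q z\<bar> \<le> a_bar * norm (p - q)"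
      using AE_bounded
    proof eventually_elim
      case (elim z)
      have "\<bar>?h p z - ?h q z\<bar> \<le> \<bar>snd z \<bullet> (p - q)\<bar>" by (auto simp: inner_diff_right)
      also have "\<dots> \<le> norm (snd z) * norm (p - q)" by (rule Cauchy_Schwarz_ineq2)
      also have "\<dots> \<le> a_bar * norm (p - q)" using elim by (intro mult_right_mono) auto
      finally show ?case .
    qed
  qed (use integrable_margin in auto)
  also have "\<dots> = a_bar * norm (p - q)" by (simp add: prob_space)
  finally have "\<bar>(\<integral>z. ?h p z \<partial>P) - (\<integral>z. ?h q z \<partial>P)\<bar> \<le> a_bar * norm (p - q)" .
  moreover have "\<bar>d \<bullet> p - d \<bullet> q\<bar> \<le> norm d * norm (p - q)"
    using Cauchy_Schwarz_ineq2[of d "p - q"] by (simp add: inner_diff_right)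
  ultimately show ?thesis unfolding dual_objective_def by (simp add: distrib_right)
qed

lemma continuous_on_dual_objective: "continuous_on S (dual_objective P d)"
proof -
  have "(norm d + a_bar)-lipschitz_on S (dual_objective P d)"
    using dual_objective_lipschitz[of d] bounds_nonneg
    by (intro lipschitz_onI) (auto simp: dist_norm)
  then show ?thesis by (rule lipschitz_on_continuous_on)
qed

lemma dual_objective_ge: "d \<bullet> p \<le> dual_objective P d p"
  unfolding dual_objective_def by simp

lemma dual_objective_0_le: "dual_objective P d 0 \<le> r_bar"
proof -
  have "(\<integral>z. max 0 (fst z - snd z \<bullet> 0) \<partial>P) \<le> (\<integral>z. r_bar \<partial>P)"
  proof (rule integral_mono_AE)
    show "AE z in P. max 0 (fst z - snd z \<bullet> 0) \<le> r_bar"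
      using AE_bounded by eventually_elim (use bounds_nonneg in auto)
  qed (use integrable_margin[of 0] in auto)
  then show ?thesis by (simp add: dual_objective_def prob_space)
qed

text \<open>The choice behind \<open>p_star\<close> is informative only once a minimizer exists.
  Compactness gives one on \<open>Omega_p\<close>; in the rest of the orthant the linear term alone
  exceeds \<open>r_bar\<close>, which bounds the value at \<open>0\<close>.\<close>

lemma p_star_minimizes:
  assumes "0 < d_lo" and d: "d \<in> Omega_d d_lo d_hi"
  shows "0 \<le> p_star P d $ i"
    and "(\<And>i. 0 \<le> q $ i) \<Longrightarrow> dual_objective P d (p_star P d) \<le> dual_objective P d q"
proof -
  let ?f = "dual_objective P d" and ?S = "{p :: real ^ 'm. \<forall>i. 0 \<le> p $ i}"
  have zero: "0 \<in> Omega_p r_bar d_lo"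
    using bounds_nonneg assms by (simp add: Omega_p_def)
  then obtain p where p: "p \<in> Omega_p r_bar d_lo" "\<And>q. q \<in> Omega_p r_bar d_lo \<Longrightarrow> ?f p \<le> ?f q"
    using continuous_attains_inf[OF compact_Omega_p _ continuous_on_dual_objective] by blast
  have min_p: "?f p \<le> ?f q" if q: "q \<in> ?S" for q
  proof (cases "q \<in> Omega_p r_bar d_lo")
    case False
    then have "\<not> (\<Sum>i\<in>UNIV. q $ i) \<le> r_bar / d_lo"
      using q by (simp add: Omega_p_def)
    then have "r_bar < d_lo * (\<Sum>i\<in>UNIV. q $ i)"
      using assms by (simp add: not_le divide_less_eq mult.commute)
    also have "\<dots> \<le> d \<bullet> q"
      unfolding inner_vec_def sum_distrib_left
      using d q by (intro sum_mono) (auto simp: Omega_d_def intro: mult_right_mono less_imp_le)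
    finally have "r_bar < ?f q" using dual_objective_ge[of d q] by linarith
    then show ?thesis using p(2)[OF zero] dual_objective_0_le[of d] by linarith
  qed (use p in blast)
  have "is_arg_min ?f (\<lambda>x. x \<in> ?S) (p_star P d)"
    unfolding p_star_def arg_min_on_def arg_min_def
  proof (rule someI)
    show "is_arg_min ?f (\<lambda>x. x \<in> ?S) p"
      using p(1) min_p by (auto simp: is_arg_min_linorder Omega_p_def)
  qed
  then show "0 \<le> p_star P d $ i"
    and "(\<And>i. 0 \<le> q $ i) \<Longrightarrow> ?f (p_star P d) \<le> ?f q"
    by (auto simp: is_arg_min_linorder)
qed

text \<open>Strictness comes from \<open>d_lo < d $ i\<close> at a positive price. It leaves room to
  raise a price while staying in \<open>Omega_p\<close>, where the regularity assumption
  applies.\<close>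

lemma sum_p_star_less:
  assumes "0 < d_lo" and d: "d \<in> Omega_d d_lo d_hi" and pos: "0 < p_star P d $ i"
  shows "(\<Sum>i\<in>UNIV. p_star P d $ i) < r_bar / d_lo"
proof -
  let ?p = "p_star P d"
  have "d_lo * (\<Sum>i\<in>UNIV. ?p $ i) < d \<bullet> ?p"
    unfolding inner_vec_def sum_distrib_left
  proof (rule sum_strict_mono_ex1)
    show "\<forall>i\<in>UNIV. d_lo * ?p $ i \<le> d $ i \<bullet> ?p $ i"
      using d p_star_minimizes(1)[OF assms(1,2)]
      by (auto simp: Omega_d_def intro: mult_right_mono less_imp_le)
    show "\<exists>i\<in>UNIV. d_lo * ?p $ i < d $ i \<bullet> ?p $ i"
      using d pos by (auto simp: Omega_d_def intro!: exI[of _ i])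
  qed simp
  also have "\<dots> \<le> dual_objective P d 0"
    using dual_objective_ge[of d ?p] p_star_minimizes(2)[OF assms(1,2), of 0] by simp
  also have "\<dots> \<le> r_bar" by (rule dual_objective_0_le)
  finally show ?thesis using assms(1) by (simp add: less_divide_eq mult.commute)
qed

section \<open>Mean consumption and complementarity at the optimal price\<close>

text \<open>Tower property: \<open>snd z $ i\<close> is measurable for the conditioning algebra, so
  the decision may be replaced by its conditional expectation. This carries Lipschitz bounds on
  acceptance probabilities over to \<open>consumption\<close>.\<close>

lemma consumption_eq_accept_prob:
  "integrable P (\<lambda>z. snd z $ i * accept_prob P p z)"
  "consumption p $ i = (\<integral>z. snd z $ i * accept_prob P p z \<partial>P)"
proof -
  let ?F = "vimage_algebra (space P) snd (borel :: (real ^ 'm) measure)"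
  have snd_meas: "snd \<in> measurable P (borel :: (real ^ 'm) measure)"
    unfolding measurable_cong_sets[OF sets_P refl]
    by (intro borel_measurable_continuous_onI continuous_intros)
  have "snd -` A \<in> sets P" if "A \<in> sets borel" for A :: "(real ^ 'm) set"
    using measurable_sets[OF snd_meas that] by (simp add: space_P)
  then have "subalgebra P ?F"
    by (auto simp: subalgebra_def sets_vimage_algebra2 space_P)
  then interpret finite_measure_subalgebra P ?F
    by unfold_locales
  have [measurable]: "(\<lambda>z. snd z $ i) \<in> borel_measurable ?F"
  proof -
    have "snd \<in> measurable ?F (borel :: (real ^ 'm) measure)"
      by (intro measurable_vimage_algebra1) (simp add: space_P)
    from measurable_compose[OF this, of "\<lambda>a. a $ i" borel] show ?thesis by simp
  qed
  show "integrable P (\<lambda>z. snd z $ i * accept_prob P p z)"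
    "consumption p $ i = (\<integral>z. snd z $ i * accept_prob P p z \<partial>P)"
    using real_cond_exp_intg[of "\<lambda>z. snd z $ i" "threshold_decision p"] integrable_consumption
    unfolding accept_prob_def indicator_accept by (auto simp: consumption_def)
qed

text \<open>At a zero price strict complementarity gives the claim. At a positive price it gives
  only the opposite inequality, so the claim is derived from first-order optimality, by raising that
  price slightly.\<close>

lemma consumption_p_star_le:
  assumes "0 < d_lo" and d: "d \<in> Omega_d d_lo d_hi" and "0 < mu"
    and reg: "accept_prob_regular r_bar d_lo d_hi lam mu P" and sc: "strict_complementarity d P"
  shows "consumption (p_star P d) $ i \<le> d $ i"
proof (cases "p_star P d $ i = 0")
  case True
  then show ?thesis
    using sc by (simp add: strict_complementarity_def indicator_accept consumption_def)
next
  case False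
  define p where "p = p_star P d"
  have p_nonneg: "0 \<le> p $ k" for k
    using p_star_minimizes(1)[OF assms(1,2)] by (simp add: p_def)
  with False have pos: "0 < p $ i" by (simp add: p_def order_less_le)
  define q where "q h = p + h *\<^sub>R axis i 1" for h
  \<comment> \<open>\<open>h0\<close> is the largest increase of one price that stays in
    \<open>Omega_p\<close>.\<close>
  define h0 where "h0 = r_bar / d_lo - (\<Sum>k\<in>UNIV. p $ k)"
  have h0: "0 < h0"
    using sum_p_star_less[OF assms(1,2)] pos by (simp add: h0_def p_def)
  \<comment> \<open>One factor \<open>a_bar\<close> bounds the weight \<open>snd z $ i\<close>, the
    other the change of \<open>snd z \<bullet> q h\<close> per unit of \<open>h\<close>.\<close>
  define C where "C = mu * a_bar\<^sup>2"
  have C: "0 \<le> C" using assms by (simp add: C_def)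
  have inner_q: "a \<bullet> q h = a \<bullet> p + h * a $ i" for a h
    by (simp add: q_def inner_add_right inner_axis)
  have q_nonneg: "0 \<le> q h $ k" if "0 < h" for h k
    using p_nonneg[of k] that by (simp add: q_def axis_def)
  \<comment> \<open>The one-sided derivative at \<open>p\<close> itself would pick up the ties \<open>r = a\<^sup>T p\<close>; the upper Lipschitz
    bound on the acceptance probability rules them out in the limit \<open>h \<rightarrow> 0\<close>.\<close>
  have upper: "consumption (q h) $ i \<le> d $ i" if h: "0 < h" for h
  proof -
    have "h * consumption (q h) $ i = (\<integral>z. h * (snd z $ i * threshold_decision (q h) z) \<partial>P)"
      by (simp add: consumption_def)
    \<comment> \<open>Convexity of the positive part, with the subgradient taken at
      \<open>q h\<close> rather than at \<open>p\<close>.\<close>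
    also have "\<dots> \<le> (\<integral>z. max 0 (fst z - snd z \<bullet> p) - max 0 (fst z - snd z \<bullet> q h) \<partial>P)"
    proof (rule integral_mono)
      show "h * (snd z $ i * threshold_decision (q h) z)
          \<le> max 0 (fst z - snd z \<bullet> p) - max 0 (fst z - snd z \<bullet> q h)" for z
        by (auto simp: threshold_decision_def inner_q)
    qed (use integrable_consumption integrable_margin in auto)
    also have "\<dots> = h * d $ i + dual_objective P d p - dual_objective P d (q h)"
      using integrable_margin by (simp add: dual_objective_def inner_q[of d])
    also have "\<dots> \<le> h * d $ i"
      using p_star_minimizes(2)[OF assms(1,2) q_nonneg[OF h]] by (simp add: p_def)
    finally show ?thesis using h by simp
  qed
  have close: "consumption p $ i \<le> consumption (q h) $ i + C * h" if h: "0 < h" "h \<le> h0" for h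
  proof -
    have "q h $ k = p $ k + (if k = i then h else 0)" for k
      by (simp add: q_def axis_def)
    then have "(\<Sum>k\<in>UNIV. q h $ k) = (\<Sum>k\<in>UNIV. p $ k) + h"
      by (simp add: sum.distrib)
    then have "q h \<in> Omega_p r_bar d_lo"
      using q_nonneg h by (auto simp: Omega_p_def h0_def)
    then have lip: "AE z in P. \<bar>accept_prob P (q h) z - accept_prob P p z\<bar>
        \<le> mu * \<bar>snd z \<bullet> q h - snd z \<bullet> p\<bar>"
      using reg d unfolding accept_prob_regular_def p_def by (auto elim: eventually_mono)
    have "consumption p $ i - consumption (q h) $ i
        = (\<integral>z. snd z $ i * accept_prob P p z - snd z $ i * accept_prob P (q h) z \<partial>P)"
      using consumption_eq_accept_prob by simp
    also have "\<dots> \<le> (\<integral>z. C * h \<partial>P)"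
    proof (rule integral_mono_AE)
      show "AE z in P. snd z $ i * accept_prob P p z - snd z $ i * accept_prob P (q h) z \<le> C * h"
        using lip AE_bounded
      proof eventually_elim
        case (elim z)
        have a: "\<bar>snd z $ i\<bar> \<le> a_bar"
          using component_le_norm_cart[of "snd z" i] elim by linarith
        have "snd z $ i * accept_prob P p z - snd z $ i * accept_prob P (q h) z
            \<le> \<bar>snd z $ i * (accept_prob P (q h) z - accept_prob P p z)\<bar>"
          unfolding right_diff_distrib by linarith
        also have "\<dots> = \<bar>snd z $ i\<bar> * \<bar>accept_prob P (q h) z - accept_prob P p z\<bar>"
          by (rule abs_mult)
        also have "\<dots> \<le> \<bar>snd z $ i\<bar> * (mu * (h * \<bar>snd z $ i\<bar>))"
          using elim h by (intro mult_left_mono) (auto simp: inner_q abs_mult)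
        also have "\<dots> \<le> a_bar * (mu * (h * a_bar))"
          using a h assms by (intro mult_mono) auto
        finally show ?case by (simp add: C_def power2_eq_square mult_ac)
      qed
    qed (use consumption_eq_accept_prob in auto)
    finally show ?thesis by (simp add: prob_space)
  qed
  have "consumption p $ i \<le> d $ i"
  proof (rule field_le_epsilon)
    fix e :: real assume e: "0 < e"
    \<comment> \<open>The denominator \<open>C + 1\<close> stays positive when \<open>C = 0\<close>
      and still gives \<open>C * h \<le> e\<close>.\<close>
    define h where "h = min h0 (e / (C + 1))"
    have h: "0 < h" "h \<le> h0" using h0 e C by (auto simp: h_def)
    have "C * h \<le> C * (e / (C + 1))" using C by (intro mult_left_mono) (auto simp: h_def)
    also have "\<dots> \<le> e" using C e by (simp add: divide_le_eq)
    finally show "consumption p $ i \<le> d $ i + e"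
      using upper[of h] close[OF h] h by linarith
  qed
  then show ?thesis by (simp add: p_def)
qed

lemma p_star_slack_nonpos:
  assumes "0 < d_lo" and d: "d \<in> Omega_d d_lo d_hi" and sc: "strict_complementarity d P"
  shows "p_star P d $ i * (d $ i - consumption (p_star P d) $ i) \<le> 0"
proof (cases "p_star P d $ i = 0")
  case False
  then have "d $ i - consumption (p_star P d) $ i \<le> 0"
    using sc by (simp add: strict_complementarity_def indicator_accept consumption_def not_less)
  then show ?thesis
    using p_star_minimizes(1)[OF assms(1,2)] by (rule mult_nonneg_nonpos[rotated])
qed simp

section \<open>Moments of the stopped excess and the expected regret\<close>

lemma measurable_within_budget:
  assumes "t \<le> n"
  shows "Measurable.pred (PiM {..<n} (\<lambda>_. P)) (within_budget b p t)"
proof -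
  have comp: "(\<lambda>w. snd (w j) $ i * threshold_decision p (w j)) \<in> borel_measurable (PiM {..<n} (\<lambda>_. P))"
    if "j < n" for i j
    using that by (intro measurable_compose[OF measurable_component_singleton[of j "{..<n}" "\<lambda>_. P"],
        of "\<lambda>z. snd z $ i * threshold_decision p z"]) auto
  have [measurable]: "(\<lambda>w. \<Sum>j<Suc s. snd (w j) $ i * threshold_decision p (w j))
      \<in> borel_measurable (PiM {..<n} (\<lambda>_. P))" if "s < t" for s i
    using that assms by (intro borel_measurable_sum comp) auto
  have "Measurable.pred (PiM {..<n} (\<lambda>_. P))
      (\<lambda>w. \<forall>s\<in>{..<t}. \<forall>i\<in>UNIV. (\<Sum>j<Suc s. snd (w j) $ i * threshold_decision p (w j)) \<le> b $ i)"
    by (intro pred_intros_finite) (auto simp del: sum.lessThan_Suc)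
  then show ?thesis by (simp add: within_budget_def[abs_def] del: sum.lessThan_Suc)
qed

text \<open>An instance of \<open>predictable_sum_square\<close>: consumption and its mean are both
  bounded by \<open>a_bar\<close>, so the centred increment is bounded by
  \<open>2 * a_bar\<close>.\<close>

lemma stopped_excess_moments:
  fixes b p :: "real ^ 'm" and n :: nat and i :: 'm
  defines "N \<equiv> stopped_excess b p (consumption p) i n"
  shows "integrable (PiM {..<n} (\<lambda>_. P)) N"
    and "integrable (PiM {..<n} (\<lambda>_. P)) (\<lambda>w. (N w)\<^sup>2)"
    and "(\<integral>w. (N w)\<^sup>2 \<partial>PiM {..<n} (\<lambda>_. P)) \<le> real n * (2 * a_bar)\<^sup>2"
proof -
  let ?X = "\<lambda>z. snd z $ i * threshold_decision p z - consumption p $ i"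
  let ?A = "\<lambda>t w. of_bool (within_budget b p t w) :: real"
  have N: "N = (\<lambda>w. \<Sum>j<n. ?A j w * ?X (w j))"
    by (simp add: N_def stopped_excess_def[abs_def])
  have X: "?X \<in> borel_measurable P" by measurable
  have X_le: "AE z in P. \<bar>?X z\<bar> \<le> 2 * a_bar"
    using AE_bounded
  proof eventually_elim
    case (elim z)
    then show ?case
      using abs_consumption_le[of z i p] abs_consumption_nth_le[of p i] by linarith
  qed
  have X_mean: "expectation ?X = 0"
    using integrable_consumption by (simp add: consumption_def prob_space)
  have A: "?A t \<in> borel_measurable (PiM {..<n} (\<lambda>_. P))" if "t \<le> n" for t n
  proof -
    note [measurable] = measurable_within_budget[OF that]
    show ?thesis unfolding of_bool_def by measurable
  qed
  have A_upd: "?A t (w(k := z)) = ?A t w" if "t \<le> k" for t k w z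
  proof -
    have "(\<Sum>j<Suc s. snd ((w(k := z)) j) $ i * threshold_decision p ((w(k := z)) j))
        = (\<Sum>j<Suc s. snd (w j) $ i * threshold_decision p (w j))" if "s < t" for s i
      using that \<open>t \<le> k\<close> by (intro sum.cong) auto
    then show ?thesis by (auto simp: within_budget_def simp del: sum.lessThan_Suc)
  qed
  note * = predictable_sum_square[OF X X_le X_mean A _ A_upd, where n=n]
  show "integrable (PiM {..<n} (\<lambda>_. P)) N"
    "integrable (PiM {..<n} (\<lambda>_. P)) (\<lambda>w. (N w)\<^sup>2)"
    "(\<integral>w. (N w)\<^sup>2 \<partial>PiM {..<n} (\<lambda>_. P)) \<le> real n * (2 * a_bar)\<^sup>2"
    unfolding N by (rule *; simp)+
qed

lemma expected_abs_stopped_excess_le: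
  assumes "0 < n"
  shows "(\<integral>w. \<bar>stopped_excess b p (consumption p) i n w\<bar> \<partial>PiM {..<n} (\<lambda>_. P))
    \<le> (1 + 4 * a_bar\<^sup>2) / 2 * sqrt (real n)"
proof -
  let ?PM = "PiM {..<n} (\<lambda>_. P)" and ?N = "stopped_excess b p (consumption p) i n"
  interpret PM: prob_space ?PM by (intro prob_space_PiM prob_space_axioms)
  have sqrt: "0 < sqrt (real n)" using assms by simp
  \<comment> \<open>With the scale \<open>sqrt n\<close>, a second moment of order \<open>n\<close>
    makes both summands of order \<open>sqrt n\<close>.\<close>
  have AMGM: "\<bar>s\<bar> \<le> (s\<^sup>2 / sqrt (real n) + sqrt (real n)) / 2" for s
  proof -
    have "0 \<le> (\<bar>s\<bar> - sqrt (real n))\<^sup>2" by simp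
    then have "2 * \<bar>s\<bar> * sqrt (real n) \<le> s\<^sup>2 + sqrt (real n) * sqrt (real n)"
      by (simp add: power2_diff)
    then show ?thesis using sqrt by (simp add: field_simps)
  qed
  have "(\<integral>w. \<bar>?N w\<bar> \<partial>?PM) \<le> (\<integral>w. ((?N w)\<^sup>2 / sqrt (real n) + sqrt (real n)) / 2 \<partial>?PM)"
    by (rule integral_mono) (use stopped_excess_moments AMGM in auto)
  also have "\<dots> = ((\<integral>w. (?N w)\<^sup>2 \<partial>?PM) / sqrt (real n) + sqrt (real n)) / 2"
    using stopped_excess_moments(2) by (simp add: PM.prob_space)
  also have "\<dots> \<le> (real n * (2 * a_bar)\<^sup>2 / sqrt (real n) + sqrt (real n)) / 2"
    using stopped_excess_moments(3) sqrt by (intro divide_right_mono add_right_mono) auto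
  also have "\<dots> = (1 + 4 * a_bar\<^sup>2) / 2 * sqrt (real n)"
    using assms by (simp add: real_div_sqrt power_mult_distrib field_simps flip: times_divide_eq_left)
  finally show ?thesis .
qed

text \<open>The pathwise bound is integrated: each of the \<open>CARD('m)\<close> resources
  contributes order \<open>sqrt n\<close>, and the priced slack \<open>Z\<close> has nonpositive
  mean by \<open>p_star_slack_nonpos\<close>.\<close>

lemma expected_regret_le:
  assumes d_lo: "0 < d_lo" and d: "d \<in> Omega_d d_lo d_hi" and "0 < mu"
    and reg: "accept_prob_regular r_bar d_lo d_hi lam mu P" and sc: "strict_complementarity d P"
    and n: "0 < n"
  shows "(\<integral>w. lp_value n (real n *\<^sub>R d) w - reward n w (policy1 n d P w) \<partial>PiM {..<n} (\<lambda>_. P))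
    \<le> r_bar * (1 + real CARD('m) * ((1 + 4 * a_bar\<^sup>2) / 2) / d_lo) * sqrt (real n)"
proof -
  let ?PM = "PiM {..<n} (\<lambda>_. P)"
  interpret PM: prob_space ?PM by (intro prob_space_PiM prob_space_axioms)
  define b where "b = real n *\<^sub>R d"
  define p where "p = p_star P d"
  define g where "g = consumption p"
  define c where "c = (1 + 4 * a_bar\<^sup>2) / 2"
  let ?N = "\<lambda>i. stopped_excess b p g i n"
  define Z where "Z w = (\<Sum>j<n. \<Sum>i\<in>UNIV. p $ i * (d $ i - snd (w j) $ i * threshold_decision p (w j)))"
    for w :: "nat \<Rightarrow> 'm obs"
  define H where "H w = r_bar * (1 + (\<Sum>i\<in>UNIV. \<bar>?N i w\<bar>) / d_lo) + Z w" for w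
  let ?L = "\<lambda>w. lp_value n b w - reward n w (threshold_policy b p w)"
  let ?K = "r_bar * (1 + real CARD('m) * c / d_lo) * sqrt (real n)"
  have c: "0 \<le> c" by (simp add: c_def)
  have int_N: "integrable ?PM (\<lambda>w. (\<Sum>i\<in>UNIV. \<bar>?N i w\<bar>))"
    unfolding g_def using stopped_excess_moments(1) by auto
  have slack: "integrable P (\<lambda>z. p $ i * (d $ i - snd z $ i * threshold_decision p z))"
    "expectation (\<lambda>z. p $ i * (d $ i - snd z $ i * threshold_decision p z)) \<le> 0" for i
    using integrable_consumption[of i p] p_star_slack_nonpos[OF d_lo d sc, of i]
    by (simp_all add: prob_space consumption_def p_def)
  have int_Z: "integrable ?PM Z"
    unfolding Z_def[abs_def]
    by (intro Bochner_Integration.integrable_sum PiM_component(1)[OF _ slack(1)]) auto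
  have "(\<integral>w. Z w \<partial>?PM) = (\<Sum>j<n. \<Sum>i\<in>UNIV.
      \<integral>w. p $ i * (d $ i - snd (w j) $ i * threshold_decision p (w j)) \<partial>?PM)"
    unfolding Z_def
    by (intro trans[OF Bochner_Integration.integral_sum] sum.cong refl Bochner_Integration.integral_sum
        Bochner_Integration.integrable_sum PiM_component(1)[OF _ slack(1)]) auto
  also have "\<dots>
      = (\<Sum>j<n. \<Sum>i\<in>UNIV. expectation (\<lambda>z. p $ i * (d $ i - snd z $ i * threshold_decision p z)))"
    by (intro sum.cong refl PiM_component(2)[OF _ slack(1)]) auto
  also have "\<dots> \<le> 0" by (intro sum_nonpos slack)
  finally have Z: "(\<integral>w. Z w \<partial>?PM) \<le> 0" .
  have int_H: "integrable ?PM H"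
    unfolding H_def[abs_def] using int_N int_Z by simp
  \<comment> \<open>This absorbs the summand \<open>1\<close> for the overrunning step into
    \<open>sqrt n\<close>.\<close>
  have sqrt1: "1 \<le> sqrt (real n)" using n by simp
  have "(\<integral>w. (\<Sum>i\<in>UNIV. \<bar>?N i w\<bar>) \<partial>?PM) = (\<Sum>i\<in>UNIV. \<integral>w. \<bar>?N i w\<bar> \<partial>?PM)"
    unfolding g_def using stopped_excess_moments(1) by (intro Bochner_Integration.integral_sum) auto
  also have "\<dots> \<le> (\<Sum>i\<in>(UNIV::'m set). c * sqrt (real n))"
    unfolding g_def c_def by (intro sum_mono expected_abs_stopped_excess_le n)
  finally have N: "(\<integral>w. (\<Sum>i\<in>UNIV. \<bar>?N i w\<bar>) \<partial>?PM) \<le> real CARD('m) * c * sqrt (real n)"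
    by simp
  have "(\<integral>w. H w \<partial>?PM) = r_bar * (1 + (\<integral>w. (\<Sum>i\<in>UNIV. \<bar>?N i w\<bar>) \<partial>?PM) / d_lo) + (\<integral>w. Z w \<partial>?PM)"
    unfolding H_def using int_N int_Z by (simp add: PM.prob_space)
  also have "\<dots> \<le> r_bar * (sqrt (real n) + real CARD('m) * c * sqrt (real n) / d_lo) + 0"
    using N Z d_lo bounds_nonneg sqrt1
    by (intro add_mono mult_left_mono divide_right_mono) auto
  also have "\<dots> = ?K" by (simp add: algebra_simps)
  finally have H: "(\<integral>w. H w \<partial>?PM) \<le> ?K" .
  have "AE w in ?PM. \<forall>j\<in>{..<n}. \<bar>fst (w j)\<bar> \<le> r_bar"
    using AE_bounded
    by (intro AE_finite_allI AE_PiM_component prob_space_axioms) (auto elim: eventually_mono)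
  then have L_le_H: "AE w in ?PM. ?L w \<le> H w"
  proof eventually_elim
    case (elim w)
    show ?case
      unfolding b_def H_def Z_def
    proof (rule regret_pathwise)
      show "d_lo \<le> d $ i" for i using d by (simp add: Omega_d_def less_imp_le)
      show "g $ i \<le> d $ i" for i
        unfolding g_def p_def by (rule consumption_p_star_le[OF d_lo d \<open>0 < mu\<close> reg sc])
      show "0 \<le> p $ i" for i unfolding p_def by (rule p_star_minimizes(1)[OF d_lo d])
    qed (use d_lo bounds_nonneg elim in auto)
  qed
  \<comment> \<open>A non-integrable regret would have the junk value \<open>0\<close> as its Bochner integral.\<close>
  have "(\<integral>w. ?L w \<partial>?PM) \<le> ?K"
  proof (cases "integrable ?PM ?L")
    case True
    from integral_mono_AE[OF this int_H L_le_H] H show ?thesis by linarith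
  next
    case False
    then show ?thesis
      using c d_lo bounds_nonneg by (simp add: not_integrable_integral_eq)
  qed
  then show ?thesis by (simp add: b_def p_def c_def policy1_def)
qed

end

theorem theorem3:
  fixes r_bar a_bar d_lo d_hi lam_min lam mu :: real
  assumes "0 < d_lo" and "d_lo < d_hi"
    and "0 < lam_min" and "0 < lam" and "0 < mu"
  shows "\<exists>K::real. \<forall>n>CARD('m::finite). \<forall>d \<in> (Omega_d d_lo d_hi :: (real ^ 'm) set).
    worst_case_regret (Xi r_bar a_bar d_lo d_hi lam_min lam mu d) n (real n *\<^sub>R d) (policy1 n d)
      \<le> ereal (K * sqrt (real n))"
proof (intro exI allI impI ballI)
  fix n :: nat and d :: "real ^ 'm"
  assume n: "CARD('m) < n" and d: "d \<in> Omega_d d_lo d_hi"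
  \<comment> \<open>The factor before \<open>sqrt n\<close> contains neither \<open>n\<close>,
    \<open>d\<close> nor \<open>P\<close>, so it serves as \<open>K\<close>. If \<open>r_bar\<close>
    is negative the family is empty, and its supremum \<open>-\<infinity>\<close> lies below the
    then negative bound.\<close>
  show "worst_case_regret (Xi r_bar a_bar d_lo d_hi lam_min lam mu d) n (real n *\<^sub>R d) (policy1 n d)
      \<le> ereal (r_bar * (1 + real CARD('m) * ((1 + 4 * a_bar\<^sup>2) / 2) / d_lo) * sqrt (real n))"
    unfolding worst_case_regret_def
  proof (rule SUP_least)
    fix P assume P: "P \<in> Xi r_bar a_bar d_lo d_hi lam_min lam mu d"
    then interpret bounded_observations P r_bar a_bar
      by (simp add: Xi_def bounded_observations_def bounded_observations_axioms_def)
    show "ereal (\<integral>w. lp_value n (real n *\<^sub>R d) w - reward n w (policy1 n d P w) \<partial>PiM {..<n} (\<lambda>_. P))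
        \<le> ereal (r_bar * (1 + real CARD('m) * ((1 + 4 * a_bar\<^sup>2) / 2) / d_lo) * sqrt (real n))"
      unfolding ereal_less_eq
      by (rule expected_regret_le[OF assms(1) d assms(5)]) (use P n in \<open>auto simp: Xi_def\<close>)
  qed
qed

end
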